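(* Let $\mathcal{A}$ be an indexing collection on $(\mathcal{T},m)$. If $\mathcal{A}$ is totally ordered by inclusion, then the set-indexed fractional Brownian motion on $(\mathcal{T},\mathcal{A},m)$ can be defined for $0<H<1$; that is, for every $H\in(0,1)$ there exists a centered Gaussian process $X=\{X_U;\ U\in\mathcal{A}\}$ such that $$\forall U,V\in\mathcal{A};\quad E[X_UX_V]=\frac12\left[m(U)^{2H}+m(V)^{2H}-m(U\bigtriangleup V)^{2H}\right].$$
   Context: Setting: $\mathcal{T}$ is a locally compact metric space equipped with a Radon measure $m$; $\overline{(\cdot)}$ denotes closure and $(\cdot)^\circ$ interior. For a class $\mathcal{D}$ of sets, $\mathcal{D}(u)$ denotes the class of finite unions of sets of $\mathcal{D}$. Indexing collection: a nonempty class $\mathcal{A}$ of compact connected subsets of $\mathcal{T}$ such that (1) $\emptyset\in\mathcal{A}$, and $A^\circ\neq A$ if $A\in\mathcal{A}$, $A\notin\{\emptyset,\mathcal{T}\}$; there is an increasing sequence $(B_n)_{n\in\mathbf{N}}$ in $\mathcal{A}(u)$ with $\mathcal{T}=\bigcup_n B_n^\circ$. (2) $\mathcal{A}$ is closed under arbitrary intersections; if $A,B\in\mathcal{A}$ are nonempty then $A\cap B\neq\emptyset$; if $(A_i)$ is an increasing sequence in $\mathcal{A}$ and there is $n$ with $A_i\subseteq B_n$ for all $i$, then $\overline{\bigcup_i A_i}\in\mathcal{A}$. (3) The $\sigma$-algebra generated by $\mathcal{A}$ is the Borel $\sigma$-algebra of $\mathcal{T}$. (4) (Separability from above) There exist an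 increasing sequence of finite subclasses $\mathcal{A}_n=\{A^n_1,\dots,A^n_{k_n}\}$ of $\mathcal{A}$, closed under intersections and satisfying $\emptyset,B_n\in\mathcal{A}_n(u)$, and functions $g_n:\mathcal{A}\to\mathcal{A}_n(u)\cup\{\mathcal{T}\}$ such that: (a) $g_n$ preserves arbitrary intersections and finite unions, i.e. $g_n(\bigcap_{A\in\mathcal{A}'}A)=\bigcap_{A\in\mathcal{A}'}g_n(A)$ for any $\mathcal{A}'\subseteq\mathcal{A}$, and if $\bigcup_{i=1}^kA_i=\bigcup_{j=1}^l A'_j$ then $\bigcup_{i=1}^k g_n(A_i)=\bigcup_{j=1}^l g_n(A'_j)$; (b) $A\subseteq(g_n(A))^\circ$ for each $A\in\mathcal{A}$; (c) $g_n(A)\subseteq g_k(A)$ if $n\ge k$; (d) $A=\bigcap_n g_n(A)$ for each $A\in\mathcal{A}$; (e) if $A,A'\in\mathcal{A}$ then $g_n(A)\cap A'\in\mathcal{A}$ for every $n$, and if $A'\in\mathcal{A}_n$ then $g_n(A)\cap A'\in\mathcal{A}_n$; (f) $g_n(\emptyset)=\emptyset$ for all $n$. (5) Every countable intersection of sets in $\mathcal{A}(u)$ may be expressed as the closure of a countable union of sets in $\mathcal{A}$. *)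

theory Defs
  imports "HOL-Probability.Probability"
begin

definition radon_measure :: "'a::topological_space measure \<Rightarrow> bool" where
  "radon_measure m \<longleftrightarrow>
     sets m = sets borel \<and>
     (\<forall>K. compact K \<longrightarrow> emeasure m K < \<infinity>) \<and>
     (\<forall>E\<in>sets borel. emeasure m E = (INF U\<in>{U. open U \<and> E \<subseteq> U}. emeasure m U)) \<and>
     (\<forall>U. open U \<longrightarrow> emeasure m U = (SUP K\<in>{K. compact K \<and> K \<subseteq> U}. emeasure m K))"

(* The class D(u).  Unions are over nonempty finite families, so that the requirement that the
   empty set lies in A_n(u) below has content. *)
definition finite_unions :: "'a set set \<Rightarrow> 'a set set" where
  "finite_unions D = {\<Union>F | F. finite F \<and> F \<noteq> {} \<and> F \<subseteq> D}"

(* The space T is the whole type.  Intersections are over nonempty families: the empty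
   intersection would be T, which need not belong to A. *)
locale indexing_collection_data =
  fixes \<A> :: "'a::metric_space set set"
    and B :: "nat \<Rightarrow> 'a set"
    and \<A>n :: "nat \<Rightarrow> 'a set set"
    and g :: "nat \<Rightarrow> 'a set \<Rightarrow> 'a set"
  assumes nonempty: "\<A> \<noteq> {}"
    and compact_connected: "\<And>A. A \<in> \<A> \<Longrightarrow> compact A \<and> connected A"
    and empty_mem: "{} \<in> \<A>"
    and interior_neq: "\<And>A. A \<in> \<A> \<Longrightarrow> A \<notin> {{}, UNIV} \<Longrightarrow> interior A \<noteq> A"
    and B_mem: "\<And>n. B n \<in> finite_unions \<A>"
    and B_incseq: "incseq B"
    and B_exhausts: "(\<Union>n. interior (B n)) = UNIV"
    and Inter_closed: "\<And>\<C>. \<C> \<subseteq> \<A> \<Longrightarrow> \<C> \<noteq> {} \<Longrightarrow> \<Inter>\<C> \<in> \<A>"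
    and Int_nonempty: "\<And>A A'. A \<in> \<A> \<Longrightarrow> A' \<in> \<A> \<Longrightarrow> A \<noteq> {} \<Longrightarrow> A' \<noteq> {} \<Longrightarrow> A \<inter> A' \<noteq> {}"
    and closure_incseq: "\<And>A n. range A \<subseteq> \<A> \<Longrightarrow> incseq (A :: nat \<Rightarrow> 'a set) \<Longrightarrow>
           (\<forall>i. A i \<subseteq> B n) \<Longrightarrow> closure (\<Union>i. A i) \<in> \<A>"
    and generates_borel: "sigma_sets UNIV \<A> = sets borel"
    and An_finite: "\<And>n. finite (\<A>n n)"
    and An_subset: "\<And>n. \<A>n n \<subseteq> \<A>"
    and An_incseq: "incseq \<A>n"
    and An_Int: "\<And>n A A'. A \<in> \<A>n n \<Longrightarrow> A' \<in> \<A>n n \<Longrightarrow> A \<inter> A' \<in> \<A>n n"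
    and An_empty: "\<And>n. {} \<in> finite_unions (\<A>n n)"
    and An_B: "\<And>n. B n \<in> finite_unions (\<A>n n)"
    and g_range: "\<And>n A. A \<in> \<A> \<Longrightarrow> g n A \<in> finite_unions (\<A>n n) \<union> {UNIV}"
    and g_Inter: "\<And>n \<C>. \<C> \<subseteq> \<A> \<Longrightarrow> \<C> \<noteq> {} \<Longrightarrow> g n (\<Inter>\<C>) = (\<Inter>A\<in>\<C>. g n A)"
    and g_Union: "\<And>n \<C> \<C>'. finite \<C> \<Longrightarrow> \<C> \<noteq> {} \<Longrightarrow> \<C> \<subseteq> \<A> \<Longrightarrow>
           finite \<C>' \<Longrightarrow> \<C>' \<noteq> {} \<Longrightarrow> \<C>' \<subseteq> \<A> \<Longrightarrow> \<Union>\<C> = \<Union>\<C>' \<Longrightarrow>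
           (\<Union>A\<in>\<C>. g n A) = (\<Union>A\<in>\<C>'. g n A)"
    and g_interior: "\<And>n A. A \<in> \<A> \<Longrightarrow> A \<subseteq> interior (g n A)"
    and g_antimono: "\<And>n k A. A \<in> \<A> \<Longrightarrow> k \<le> n \<Longrightarrow> g n A \<subseteq> g k A"
    and g_limit: "\<And>A. A \<in> \<A> \<Longrightarrow> A = (\<Inter>n. g n A)"
    and g_Int: "\<And>n A A'. A \<in> \<A> \<Longrightarrow> A' \<in> \<A> \<Longrightarrow> g n A \<inter> A' \<in> \<A>"
    and g_Int_An: "\<And>n A A'. A \<in> \<A> \<Longrightarrow> A' \<in> \<A>n n \<Longrightarrow> g n A \<inter> A' \<in> \<A>n n"
    and g_empty: "\<And>n. g n {} = {}"
    and countable_Inter: "\<And>\<C>. countable \<C> \<Longrightarrow> \<C> \<noteq> {} \<Longrightarrow> \<C> \<subseteq> finite_unions \<A> \<Longrightarrow>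
           \<exists>\<D>. countable \<D> \<and> \<D> \<subseteq> \<A> \<and> \<Inter>\<C> = closure (\<Union>\<D>)"

definition indexing_collection :: "'a::metric_space set set \<Rightarrow> bool" where
  "indexing_collection \<A> \<longleftrightarrow> (\<exists>B \<A>n g. indexing_collection_data \<A> B \<A>n g)"

(* Degenerate (constant) variables count as Gaussian, with standard deviation 0;
   normal_density is a probability density only for positive standard deviation. *)
definition gaussian_rv :: "'w measure \<Rightarrow> ('w \<Rightarrow> real) \<Rightarrow> bool" where
  "gaussian_rv M Y \<longleftrightarrow> Y \<in> borel_measurable M \<and>
     (\<exists>\<mu> \<sigma>. \<sigma> \<ge> 0 \<and>
        distr M borel Y =
          (if \<sigma> = 0 then return borel \<mu> else density lborel (normal_density \<mu> \<sigma>)))"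

definition gaussian_process :: "'w measure \<Rightarrow> 'i set \<Rightarrow> ('i \<Rightarrow> 'w \<Rightarrow> real) \<Rightarrow> bool" where
  "gaussian_process M I X \<longleftrightarrow>
     prob_space M \<and>
     (\<forall>i\<in>I. X i \<in> borel_measurable M) \<and>
     (\<forall>F c. finite F \<and> F \<subseteq> I \<longrightarrow> gaussian_rv M (\<lambda>\<omega>. \<Sum>i\<in>F. c i * X i \<omega>))"

definition centered_gaussian_process :: "'w measure \<Rightarrow> 'i set \<Rightarrow> ('i \<Rightarrow> 'w \<Rightarrow> real) \<Rightarrow> bool" where
  "centered_gaussian_process M I X \<longleftrightarrow>
     gaussian_process M I X \<and> (\<forall>i\<in>I. integral\<^sup>L M (X i) = 0)"

(* Values of measure are genuine here: members of an indexing collection are compact. *)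
definition set_indexed_fBm ::
    "'a measure \<Rightarrow> 'a set set \<Rightarrow> real \<Rightarrow> 'w measure \<Rightarrow> ('a set \<Rightarrow> 'w \<Rightarrow> real) \<Rightarrow> bool" where
  "set_indexed_fBm m \<A> H M X \<longleftrightarrow>
     centered_gaussian_process M \<A> X \<and>
     (\<forall>U\<in>\<A>. \<forall>V\<in>\<A>. integral\<^sup>L M (\<lambda>\<omega>. X U \<omega> * X V \<omega>) =
        1/2 * (measure m U powr (2*H) + measure m V powr (2*H) - measure m (sym_diff U V) powr (2*H)))"

end

theory Submission
  imports Defs
begin

text \<open>
  For compact \<open>U \<subseteq> V\<close> the measure of the symmetric difference is \<open>m V - m U\<close>, so on a totally
  ordered collection the required covariance is that of a fractional Brownian motion on \<open>[0, \<infinity>)\<close>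
  evaluated at the times \<open>m U\<close>. Its covariance is positive semidefinite because
  \<open>\<bar>t\<bar>\<^sup>2\<^sup>H\<close> is a positive multiple of \<open>\<integral> (1 - cos (t x)) x\<^sup>-\<^sup>1\<^sup>-\<^sup>2\<^sup>H dx\<close>. A Cholesky factorisation of the
  covariance on the dyadic times expresses the process there as finite linear combinations of
  i.i.d. standard normal variables. At any other time the process is the almost sure limit along the
  truncated binary expansions: the increments are bounded in mean by a geometric series, and
  characteristic functions carry normality over to the limit, so neither a multivariate extension
  theorem nor completeness of \<open>L\<^sup>2\<close> is needed.
\<close>

section \<open>Centered normal variables\<close>

text \<open>Describing the law as that of a scaled standard normal variable, not by a density,
  covers variance 0 without a case distinction.\<close>

definition centered_normal :: "'w measure \<Rightarrow> real \<Rightarrow> ('w \<Rightarrow> real) \<Rightarrow> bool" where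
  "centered_normal M v Y \<longleftrightarrow> Y \<in> borel_measurable M \<and> 0 \<le> v \<and>
     distr M borel Y = distr std_normal_distribution borel (\<lambda>x. sqrt v * x)"

lemma char_scaled_std_normal:
  "char (distr std_normal_distribution borel (\<lambda>x. c * x)) t = exp (- (c\<^sup>2 * t\<^sup>2 / 2))"
proof -
  have "char (distr std_normal_distribution borel (\<lambda>x. c * x)) t = char std_normal_distribution (t * c)"
    unfolding char_def by (subst integral_distr) (simp_all add: mult_ac)
  also have "\<dots> = exp (- (c\<^sup>2 * t\<^sup>2 / 2))"
    by (simp add: char_std_normal_distribution power_mult_distrib mult_ac)
  finally show ?thesis .
qed

text \<open>By Levy's uniqueness theorem normality can be checked on characteristic functions, which
  behave well under independent sums and under limits.\<close>

lemma (in prob_space) centered_normal_char: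
  assumes "Y \<in> borel_measurable M" "0 \<le> v"
  shows "centered_normal M v Y \<longleftrightarrow> (\<forall>t. char (distr M borel Y) t = exp (- (v * t\<^sup>2 / 2)))"
proof
  assume "centered_normal M v Y"
  then show "\<forall>t. char (distr M borel Y) t = exp (- (v * t\<^sup>2 / 2))"
    using assms by (simp add: centered_normal_def char_scaled_std_normal)
next
  assume *: "\<forall>t. char (distr M borel Y) t = exp (- (v * t\<^sup>2 / 2))"
  have "distr M borel Y = distr std_normal_distribution borel (\<lambda>x. sqrt v * x)"
  proof (rule Levy_uniqueness)
    show "real_distribution (distr M borel Y)"
      using assms by (intro real_distribution_distr) simp
    show "real_distribution (distr std_normal_distribution borel (\<lambda>x. sqrt v * x))"
      by (intro prob_space.real_distribution_distr prob_space_normal_density) simp_all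
  qed (use * assms in \<open>auto simp: char_scaled_std_normal\<close>)
  then show "centered_normal M v Y"
    using assms by (simp add: centered_normal_def)
qed

lemma centered_normal_gaussian_rv:
  assumes "centered_normal M v Y"
  shows "gaussian_rv M Y"
proof -
  interpret Z: prob_space std_normal_distribution
    by (rule prob_space_normal_density) simp
  have "distr std_normal_distribution borel (\<lambda>x. sqrt v * x) =
     (if sqrt v = 0 then return borel 0 else density lborel (normal_density 0 (sqrt v)))"
  proof (cases "v = 0")
    case True
    then show ?thesis
      using Z.distr_const[of 0 borel] by simp
  next
    case False
    then have "0 < sqrt v"
      using assms by (simp add: centered_normal_def)
    moreover have "distributed std_normal_distribution lborel (\<lambda>x. x) std_normal_density"
      by (auto simp: distributed_def distr_id2)
    ultimately have "distributed std_normal_distribution lborel (\<lambda>x. 0 + sqrt v * x)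
        (normal_density (0 + sqrt v * 0) (\<bar>sqrt v\<bar> * 1))"
      by (intro Z.normal_density_affine) auto
    then have "distr std_normal_distribution lborel (\<lambda>x. sqrt v * x) =
        density lborel (normal_density 0 (sqrt v))"
      using \<open>0 < sqrt v\<close> by (simp add: distributed_def)
    \<comment> \<open>\<open>distributed\<close> pushes forward to \<open>lborel\<close>; only the
      sigma-algebra of the target matters, and it is the Borel one.\<close>
    moreover have "distr std_normal_distribution lborel (\<lambda>x. sqrt v * x) =
        distr std_normal_distribution borel (\<lambda>x. sqrt v * x)"
      by (rule distr_cong) auto
    ultimately show ?thesis
      using \<open>0 < sqrt v\<close> by simp
  qed
  then show ?thesis
    using assms unfolding gaussian_rv_def centered_normal_def
    by (intro conjI exI[of _ 0] exI[of _ "sqrt v"]) auto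
qed

lemma centered_normal_moments:
  assumes "centered_normal M v Y"
  shows "integrable M Y" "integral\<^sup>L M Y = 0"
    and "integrable M (\<lambda>\<omega>. (Y \<omega>)\<^sup>2)" "(\<integral>\<omega>. (Y \<omega>)\<^sup>2 \<partial>M) = v"
proof -
  have [measurable]: "Y \<in> borel_measurable M" and v: "0 \<le> v"
    and D: "distr M borel Y = distr std_normal_distribution borel (\<lambda>x. sqrt v * x)"
    using assms by (auto simp: centered_normal_def)
  note I = integrable_std_normal_distribution_moment
  have "integrable (distr std_normal_distribution borel (\<lambda>x. sqrt v * x)) (\<lambda>x. x)"
    using integrable_mult_right[OF I[of 1], of "sqrt v"] by (subst integrable_distr_eq) simp_all
  then show "integrable M Y"
    unfolding D[symmetric] by (subst (asm) integrable_distr_eq) auto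
  have "integrable (distr std_normal_distribution borel (\<lambda>x. sqrt v * x)) (\<lambda>x. x\<^sup>2)"
    using integrable_mult_right[OF I[of 2], of "(sqrt v)\<^sup>2"]
    by (subst integrable_distr_eq) (simp_all only: power_mult_distrib, simp_all)
  then show "integrable M (\<lambda>\<omega>. (Y \<omega>)\<^sup>2)"
    unfolding D[symmetric] by (subst (asm) integrable_distr_eq) auto
  have "integral\<^sup>L M Y = (\<integral>x. x \<partial>distr M borel Y)"
    by (simp add: integral_distr)
  also have "\<dots> = sqrt v * (\<integral>x. x^1 \<partial>std_normal_distribution)"
    unfolding D by (subst integral_distr) auto
  also have "\<dots> = 0"
    by (subst integral_std_normal_distribution_moment_odd) auto
  finally show "integral\<^sup>L M Y = 0" .
  have "(\<integral>\<omega>. (Y \<omega>)\<^sup>2 \<partial>M) = (\<integral>x. x\<^sup>2 \<partial>distr M borel Y)"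
    by (simp add: integral_distr)
  also have "\<dots> = v * (\<integral>x. x^(2*1) \<partial>std_normal_distribution)"
    unfolding D using v by (subst integral_distr) (auto simp: power_mult_distrib)
  also have "\<dots> = v"
    by (subst std_normal_distribution_even_moments) (simp add: numeral_2_eq_2)
  finally show "(\<integral>\<omega>. (Y \<omega>)\<^sup>2 \<partial>M) = v" .
qed

text \<open>The functions \<open>iexp (t * Yn n \<omega>)\<close> have modulus 1, so dominated
  convergence turns almost sure convergence into convergence of characteristic functions.\<close>

lemma (in prob_space) centered_normal_limit:
  assumes Yn: "\<And>n. centered_normal M (v n) (Yn n)"
    and [measurable]: "Y \<in> borel_measurable M"
    and lim: "AE \<omega> in M. (\<lambda>n. Yn n \<omega>) \<longlonglongrightarrow> Y \<omega>" and v: "v \<longlonglongrightarrow> v'"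
  shows "centered_normal M v' Y"
proof -
  have [measurable]: "Yn n \<in> borel_measurable M" and v_nonneg: "0 \<le> v n" for n
    using Yn[of n] by (auto simp: centered_normal_def)
  have "0 \<le> v'"
    using v v_nonneg by (intro LIMSEQ_le_const) auto
  have "char (distr M borel Y) t = exp (- (v' * t\<^sup>2 / 2))" for t
  proof (rule LIMSEQ_unique)
    have "(\<lambda>n. \<integral>\<omega>. iexp (t * Yn n \<omega>) \<partial>M) \<longlonglongrightarrow> (\<integral>\<omega>. iexp (t * Y \<omega>) \<partial>M)"
    proof (rule integral_dominated_convergence[where w="\<lambda>_. 1"])
      show "AE \<omega> in M. (\<lambda>n. iexp (t * Yn n \<omega>)) \<longlonglongrightarrow> iexp (t * Y \<omega>)"
        using lim by eventually_elim (intro tendsto_intros)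
    qed auto
    then show "(\<lambda>n. char (distr M borel (Yn n)) t) \<longlonglongrightarrow> char (distr M borel Y) t"
      by (simp add: char_def integral_distr)
    have "char (distr M borel (Yn n)) t = exp (- (v n * t\<^sup>2 / 2))" for n
      using Yn[of n] v_nonneg[of n] centered_normal_char[of "Yn n" "v n"] by simp
    then show "(\<lambda>n. char (distr M borel (Yn n)) t) \<longlonglongrightarrow> exp (- (v' * t\<^sup>2 / 2))"
      using v by (auto intro!: tendsto_intros)
  qed
  then show ?thesis
    using \<open>0 \<le> v'\<close> by (simp add: centered_normal_char)
qed

section \<open>Gaussian white noise: countably many i.i.d. standard normal variables\<close>

definition gaussian_white_noise :: "(nat \<Rightarrow> real) measure" where
  "gaussian_white_noise = PiM UNIV (\<lambda>_. std_normal_distribution)"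

lemma prob_space_white_noise: "prob_space gaussian_white_noise"
  unfolding gaussian_white_noise_def
  by (intro prob_space_PiM prob_space_normal_density) simp

lemma measurable_white_noise_coordinate:
  "(\<lambda>\<omega>. \<omega> k) \<in> borel_measurable gaussian_white_noise"
proof -
  have "(\<lambda>\<omega>. \<omega> k) \<in> measurable gaussian_white_noise std_normal_distribution"
    unfolding gaussian_white_noise_def by measurable
  then show ?thesis by (simp cong: measurable_cong_sets)
qed

lemma distr_white_noise_coordinate:
  "distr gaussian_white_noise borel (\<lambda>\<omega>. \<omega> k) = std_normal_distribution"
proof -
  have "distr gaussian_white_noise borel (\<lambda>\<omega>. \<omega> k) =
      distr gaussian_white_noise std_normal_distribution (\<lambda>\<omega>. \<omega> k)"
    by (rule distr_cong) auto
  also have "\<dots> = std_normal_distribution"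
    unfolding gaussian_white_noise_def
    by (intro distr_PiM_component[where M="\<lambda>_. std_normal_distribution"] prob_space_normal_density) auto
  finally show ?thesis .
qed

lemma indep_white_noise_coordinates:
  "prob_space.indep_vars gaussian_white_noise (\<lambda>_. borel) (\<lambda>k \<omega>. \<omega> k) UNIV"
proof -
  note [measurable] = measurable_white_noise_coordinate
  interpret prob_space gaussian_white_noise by (rule prob_space_white_noise)
  \<comment> \<open>The joint map of all coordinates is the identity, so the joint law is the
    product measure itself, which is independence.\<close>
  have "distr gaussian_white_noise (\<Pi>\<^sub>M k\<in>UNIV. borel) (\<lambda>\<omega>. \<lambda>k\<in>UNIV. \<omega> k) = 
      distr gaussian_white_noise gaussian_white_noise (\<lambda>\<omega>. \<omega>)"
    by (intro distr_cong) (auto simp: gaussian_white_noise_def cong: sets_PiM_cong)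
  then show ?thesis
    by (subst indep_vars_iff_distr_eq_PiM)
      (auto simp: distr_white_noise_coordinate simp flip: gaussian_white_noise_def)
qed

text \<open>Independence factors the characteristic function of the sum, and the exponents, hence
  the variances, add up.\<close>

lemma centered_normal_white_noise:
  "centered_normal gaussian_white_noise (\<Sum>k<N. (b k)\<^sup>2) (\<lambda>\<omega>. \<Sum>k<N. b k * \<omega> k)"
proof -
  note [measurable] = measurable_white_noise_coordinate
  interpret prob_space gaussian_white_noise by (rule prob_space_white_noise)
  have "char (distr gaussian_white_noise borel (\<lambda>\<omega>. \<Sum>k<N. b k * \<omega> k)) t =
      exp (- ((\<Sum>k<N. (b k)\<^sup>2) * t\<^sup>2 / 2))" for t
  proof -
    have "indep_vars (\<lambda>_. borel) (\<lambda>k \<omega>. b k * \<omega> k) {..<N}"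
      by (rule indep_vars_compose2[OF indep_vars_subset[OF indep_white_noise_coordinates subset_UNIV]]) simp
    then have "char (distr gaussian_white_noise borel (\<lambda>\<omega>. \<Sum>k<N. b k * \<omega> k)) t =
        (\<Prod>k<N. char (distr gaussian_white_noise borel (\<lambda>\<omega>. b k * \<omega> k)) t)"
      by (rule char_distr_sum)
    also have "distr gaussian_white_noise borel (\<lambda>\<omega>. b k * \<omega> k) =
        distr std_normal_distribution borel (\<lambda>x. b k * x)" for k
      using distr_distr[of "\<lambda>x. b k * x" borel borel "\<lambda>\<omega>. \<omega> k" gaussian_white_noise]
      by (simp add: comp_def distr_white_noise_coordinate)
    then have "(\<Prod>k<N. char (distr gaussian_white_noise borel (\<lambda>\<omega>. b k * \<omega> k)) t) =
        exp (\<Sum>k<N. - ((b k)\<^sup>2 * t\<^sup>2 / 2))"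
      by (simp add: char_scaled_std_normal exp_sum exp_of_real[symmetric] del: of_real_exp)
    also have "(\<Sum>k<N. - ((b k)\<^sup>2 * t\<^sup>2 / 2)) = - ((\<Sum>k<N. (b k)\<^sup>2) * t\<^sup>2 / 2)"
      by (simp add: sum_negf sum_distrib_right sum_divide_distrib)
    finally show ?thesis .
  qed
  then show ?thesis
    by (subst centered_normal_char) (auto intro: sum_nonneg)
qed

section \<open>Cholesky factorisation\<close>

definition psd_kernel :: "('i \<Rightarrow> 'i \<Rightarrow> real) \<Rightarrow> bool" where
  "psd_kernel K \<longleftrightarrow> (\<forall>i j. K i j = K j i) \<and>
     (\<forall>F c. finite F \<longrightarrow> 0 \<le> (\<Sum>i\<in>F. \<Sum>j\<in>F. c i * c j * K i j))"

lemma psd_kernel_sym: "psd_kernel K \<Longrightarrow> K i j = K j i"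
  by (simp add: psd_kernel_def)

lemma psd_kernel_nonneg:
  "psd_kernel K \<Longrightarrow> finite F \<Longrightarrow> 0 \<le> (\<Sum>i\<in>F. \<Sum>j\<in>F. c i * c j * K i j)"
  by (simp add: psd_kernel_def)

text \<open>With a zero diagonal entry, the quadratic form at \<open>e_i + l e_n\<close> is affine
  in \<open>l\<close>. Nonnegativity for all \<open>l\<close> forces slope zero; otherwise the
  \<open>l\<close> chosen at the end would give the value -1.\<close>

lemma psd_kernel_diag_zero:
  assumes K: "psd_kernel K" and n: "K n n = 0"
  shows "K i n = 0"
proof (cases "i = n")
  case False
  have "0 \<le> K i i + 2 * l * K i n" for l
  proof -
    show ?thesis
      using psd_kernel_nonneg[OF K, of "{i, n}" "\<lambda>a. if a = n then l else 1"]
        False n psd_kernel_sym[OF K, of n i] by simp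
  qed
  from this[of "- (K i i + 1) / (2 * K i n)"] show ?thesis
    by (cases "K i n = 0") (auto simp: field_simps)
qed (simp add: n)

text \<open>If \<^term>\<open>K n n = 0\<close> the correction term is \<open>0 / 0 = 0\<close>, and the claim stays true. Otherwise the
  form of the Schur complement at \<open>c\<close> is the form of \<open>K\<close> at \<open>c - l e\<^sub>n\<close> for the minimising \<open>l\<close>.\<close>

lemma psd_kernel_schur:
  assumes K: "psd_kernel K"
  shows "psd_kernel (\<lambda>i j. K i j - K i n * K n j / K n n)"
  unfolding psd_kernel_def
proof (intro conjI allI impI)
  have sym: "K i j = K j i" for i j
    by (rule psd_kernel_sym[OF K])
  show "K i j - K i n * K n j / K n n = K j i - K j n * K n i / K n n" for i j
    using sym[of i j] sym[of i n] sym[of n j] by simp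
  fix F :: "'a set" and c0 :: "'a \<Rightarrow> real" assume F0: "finite F"
  \<comment> \<open>The pivot \<open>n\<close> may lie outside \<open>F\<close>, so the index set is
    enlarged and the coefficients are extended by zero.\<close>
  define G where "G = insert n F"
  define c where "c i = (if i \<in> F then c0 i else 0)" for i
  define q where "q = (\<Sum>i\<in>G. c i * K i n)"
  define l where "l = q / K n n"
  have G: "finite G" "n \<in> G"
    using F0 by (auto simp: G_def)
  have q': "(\<Sum>j\<in>G. c j * K n j) = q"
    unfolding q_def by (intro sum.cong refl) (simp only: sym[of n])
  define d where "d i = (if i = n then l else 0)" for i
  have d: "(\<Sum>i\<in>G. d i * f i) = l * f n" for f
    using G by (simp add: d_def if_distrib[of "\<lambda>x. x * _"] cong: if_cong)
  have "0 \<le> (\<Sum>i\<in>G. \<Sum>j\<in>G. (c i - d i) * (c j - d j) * K i j)"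
    by (rule psd_kernel_nonneg[OF K G(1)])
  also have "\<dots> = (\<Sum>i\<in>G. (c i - d i) * ((\<Sum>j\<in>G. c j * K i j) - l * K i n))"
    by (simp add: d[symmetric] sum_subtractf[symmetric] sum_distrib_left algebra_simps)
  also have "\<dots> = (\<Sum>i\<in>G. c i * (\<Sum>j\<in>G. c j * K i j)) - l * (\<Sum>i\<in>G. c i * K i n)
      - (\<Sum>i\<in>G. d i * ((\<Sum>j\<in>G. c j * K i j) - l * K i n))"
    by (simp add: left_diff_distrib right_diff_distrib sum_subtractf sum_distrib_left mult_ac)
  also have "\<dots> = (\<Sum>i\<in>G. c i * (\<Sum>j\<in>G. c j * K i j)) - l * q - l * (q - l * K n n)"
    by (simp only: d q_def[symmetric] q')
  \<comment> \<open>If \<open>K n n = 0\<close> then \<open>l = 0\<close>, and both sides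
    vanish.\<close>
  also have "l * q + l * (q - l * K n n) = q * q / K n n"
    by (simp add: l_def)
  then have "(\<Sum>i\<in>G. c i * (\<Sum>j\<in>G. c j * K i j)) - l * q - l * (q - l * K n n) =
      (\<Sum>i\<in>G. c i * (\<Sum>j\<in>G. c j * K i j)) - q * q / K n n"
    by simp
  also have "q * q / K n n = (\<Sum>i\<in>G. c i * (\<Sum>j\<in>G. c j * (K i n * K n j / K n n)))"
  proof -
    have "q * q / K n n = (\<Sum>i\<in>G. c i * K i n) * (\<Sum>j\<in>G. c j * K n j) / K n n"
      by (simp only: q' flip: q_def)
    also have "\<dots> = (\<Sum>i\<in>G. \<Sum>j\<in>G. c i * K i n * (c j * K n j) / K n n)"
      by (simp only: sum_product sum_divide_distrib)
    finally show ?thesis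
      by (simp add: sum_distrib_left mult_ac)
  qed
  also have "(\<Sum>i\<in>G. c i * (\<Sum>j\<in>G. c j * K i j)) - \<dots> =
      (\<Sum>i\<in>G. \<Sum>j\<in>G. c i * c j * (K i j - K i n * K n j / K n n))"
    by (simp add: sum_subtractf right_diff_distrib sum_distrib_left mult_ac)
  also have "\<dots> = (\<Sum>i\<in>F. \<Sum>j\<in>F. c0 i * c0 j * (K i j - K i n * K n j / K n n))"
    using F0 unfolding G_def
    by (intro sum.mono_neutral_cong_right) (auto simp: c_def intro!: sum.mono_neutral_cong_right)
  finally show "0 \<le> (\<Sum>i\<in>F. \<Sum>j\<in>F. c0 i * c0 j * (K i j - K i n * K n j / K n n))" .
qed

text \<open>The kernel left over after elimination with the pivots 0, ..., n - 1.\<close>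

fun schur_complement :: "(nat \<Rightarrow> nat \<Rightarrow> real) \<Rightarrow> nat \<Rightarrow> nat \<Rightarrow> nat \<Rightarrow> real" where
  "schur_complement K 0 i j = K i j"
| "schur_complement K (Suc n) i j = schur_complement K n i j -
     schur_complement K n i n * schur_complement K n n j / schur_complement K n n n"

lemma psd_kernel_schur_complement: "psd_kernel K \<Longrightarrow> psd_kernel (schur_complement K n)"
proof (induction n)
  case (Suc n)
  have "schur_complement K (Suc n) = (\<lambda>i j. schur_complement K n i j -
      schur_complement K n i n * schur_complement K n n j / schur_complement K n n n)"
    by (intro ext) simp
  then show ?case
    using psd_kernel_schur[OF Suc.IH[OF Suc.prems], of n] by simp
qed (simp add: psd_kernel_def)

text \<open>Eliminating a nonzero pivot clears its row; if the pivot is zero, semidefiniteness says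
  the row was zero already. A cleared row stays zero under later eliminations.\<close>

lemma schur_complement_eq_0:
  assumes K: "psd_kernel K"
  shows "i < n \<Longrightarrow> schur_complement K n i j = 0"
proof (induction n arbitrary: j)
  case (Suc n)
  let ?R = "schur_complement K n"
  have R: "psd_kernel ?R" by (rule psd_kernel_schur_complement[OF K])
  show ?case
  proof (cases "i = n")
    case True
    have "?R n j = 0" if "?R n n = 0"
      using psd_kernel_diag_zero[OF R that, of j] psd_kernel_sym[OF R, of n j] by simp
    then show ?thesis
      using True by auto
  qed (use Suc in auto)
qed simp

text \<open>Each elimination splits off one rank-one term, so \<open>K\<close> is the sum of the
  first \<open>N\<close> terms plus a residual whose row \<open>i\<close> is zero as soon as
  \<open>i < N\<close>.\<close>

lemma cholesky_factorisation:
  fixes K :: "nat \<Rightarrow> nat \<Rightarrow> real"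
  assumes K: "psd_kernel K"
  obtains a where "\<And>i j N. i < N \<Longrightarrow> K i j = (\<Sum>k<N. a i k * a j k)"
    and "\<And>i k. i < k \<Longrightarrow> a i k = 0"
proof
  let ?R = "schur_complement K"
  \<comment> \<open>At a zero pivot the division by \<open>sqrt 0\<close> makes the whole column
    zero.\<close>
  define a where "a i k = ?R k i k / sqrt (?R k k k)" for i k
  have R: "psd_kernel (?R n)" for n
    by (rule psd_kernel_schur_complement[OF K])
  have nonneg: "0 \<le> ?R n n n" for n
  proof -
    show ?thesis
      using psd_kernel_nonneg[OF R[of n], of "{n}" "\<lambda>_. 1"] by simp
  qed
  have "K i j = (\<Sum>k<N. a i k * a j k) + ?R N i j" for i j N
  proof (induction N)
    case (Suc N)
    have "a i N * a j N = ?R N i N * ?R N N j / ?R N N N"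
      using nonneg[of N] psd_kernel_sym[OF R, of N N j] by (simp add: a_def)
    then show ?case
      using Suc by simp
  qed simp
  then show "K i j = (\<Sum>k<N. a i k * a j k)" if "i < N" for i j N
    using schur_complement_eq_0[OF K that, of j] by (metis add.right_neutral)
  show "a i k = 0" if "i < k" for i k
    using schur_complement_eq_0[OF K that] by (simp add: a_def)
qed

section \<open>The covariance of fractional Brownian motion\<close>

definition fbm_kernel :: "real \<Rightarrow> real \<Rightarrow> real \<Rightarrow> real" where
  "fbm_kernel H s t = (\<bar>s\<bar> powr (2 * H) + \<bar>t\<bar> powr (2 * H) - \<bar>s - t\<bar> powr (2 * H)) / 2"

text \<open>Up to a constant, the spectral density of fractional Brownian motion. A half-line is
  enough because \<open>1 - cos x\<close> is even.\<close>

definition spectral_density :: "real \<Rightarrow> real \<Rightarrow> real" where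
  "spectral_density H x = indicator {0<..} x * x powr (- 1 - 2 * H)"

lemma spectral_density_nonneg: "0 \<le> spectral_density H x"
  by (simp add: spectral_density_def)

lemma measurable_spectral_density [measurable]: "spectral_density H \<in> borel_measurable borel"
  unfolding spectral_density_def by measurable

lemma one_minus_cos_eq: "1 - cos x = 2 * (sin (x / 2))\<^sup>2" for x :: real
  using cos_double_sin[of "x / 2"] by simp

lemma one_minus_cos_le: "1 - cos x \<le> x\<^sup>2" for x :: real
proof -
  have "(sin (x / 2))\<^sup>2 \<le> (x / 2)\<^sup>2"
    using abs_sin_x_le_abs_x[of "x / 2"] by (subst abs_le_square_iff[symmetric])
  then have "(sin (x / 2))\<^sup>2 \<le> x\<^sup>2 / 4"
    by (simp add: power_divide)
  then show ?thesis
    unfolding one_minus_cos_eq using zero_le_power2[of "x"] by linarith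
qed

text \<open>For nonnegative functions gauge integrability is absolute, which carries the known power
  integrals over to \<open>lborel\<close>.\<close>

lemma integrable_lborel_of_integrable_on:
  fixes f :: "real \<Rightarrow> real"
  assumes "f integrable_on S" "\<And>x. x \<in> S \<Longrightarrow> 0 \<le> f x"
    and [measurable]: "S \<in> sets borel" "f \<in> borel_measurable borel"
  shows "integrable lborel (\<lambda>x. indicator S x * f x)"
proof -
  have "set_integrable lebesgue S f"
    using assms by (intro nonnegative_absolutely_integrable_1) auto
  then have "integrable (completion lborel) (\<lambda>x. indicator S x * f x)"
    by (simp add: set_integrable_def)
  then show ?thesis
    by (subst (asm) integrable_completion) auto
qed

text \<open>Near 0 the bound \<open>1 - cos x \<le> x\<^sup>2\<close> leaves the exponent
  \<open>1 - 2 * H\<close>, above -1 as \<open>H < 1\<close>. Beyond 1 the bound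
  \<open>1 - cos x \<le> 2\<close> leaves \<open>- 1 - 2 * H\<close>, below -1 as
  \<open>0 < H\<close>.\<close>

lemma integrable_spectral_density:
  assumes H: "0 < H" "H < 1"
  shows "integrable lborel (\<lambda>x. (1 - cos x) * spectral_density H x)"
proof (rule Bochner_Integration.integrable_bound)
  show "integrable lborel (\<lambda>x. indicator {0..1} x * x powr (1 - 2 * H) +
      indicator {1..} x * (2 * x powr (- 1 - 2 * H)))"
    using H has_integral_integrable[OF has_integral_powr_to_inf[of "- 1 - 2 * H" 1]]
    by (intro Bochner_Integration.integrable_add integrable_lborel_of_integrable_on integrable_on_powr_from_0
        integrable_on_cmult_left) auto
  show "AE x in lborel. norm ((1 - cos x) * spectral_density H x) \<le>
      norm (indicator {0..1} x * x powr (1 - 2 * H) + indicator {1..} x * (2 * x powr (- 1 - 2 * H)))"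
  proof (rule AE_I2)
    fix x :: real
    consider "x \<le> 0" | "0 < x" "x \<le> 1" | "1 < x" by linarith
    then show "norm ((1 - cos x) * spectral_density H x) \<le>
      norm (indicator {0..1} x * x powr (1 - 2 * H) + indicator {1..} x * (2 * x powr (- 1 - 2 * H)))"
    proof cases
      case 2
      have "(1 - cos x) * x powr (- 1 - 2 * H) \<le> x\<^sup>2 * x powr (- 1 - 2 * H)"
        by (intro mult_right_mono one_minus_cos_le) simp
      also have "\<dots> = x powr (1 - 2 * H)"
      proof -
        have "x\<^sup>2 = x powr 2" using 2 by simp
        then show ?thesis by (simp only: powr_add[symmetric]) simp
      qed
      also have "\<dots> \<le> norm (indicator {0..1} x * x powr (1 - 2 * H) + indicator {1..} x * (2 * x powr (- 1 - 2 * H)))"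
        using 2 by (simp add: abs_of_nonneg)
      finally show ?thesis
        using 2 by (simp add: spectral_density_def abs_mult)
    next
      case 3
      have "(1 - cos x) * x powr (- 1 - 2 * H) \<le> 2 * x powr (- 1 - 2 * H)"
        using cos_ge_minus_one[of x] by (intro mult_right_mono) (linarith, simp)
      then show ?thesis
        using 3 by (simp add: spectral_density_def abs_mult)
    qed (simp add: spectral_density_def)
  qed
qed measurable

definition spectral_constant :: "real \<Rightarrow> real" where
  "spectral_constant H = (\<integral>x. (1 - cos x) * spectral_density H x \<partial>lborel)"

text \<open>A zero integral would make the nonnegative integrand vanish almost everywhere, but it is
  positive on (0, 1).\<close>

lemma spectral_constant_pos:
  assumes H: "0 < H" "H < 1"
  shows "0 < spectral_constant H"
proof -
  have nonneg: "0 \<le> (1 - cos x) * spectral_density H x" for x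
    by (simp add: spectral_density_nonneg)
  have "spectral_constant H \<noteq> 0"
  proof
    assume "spectral_constant H = 0"
    then have "AE x in lborel. (1 - cos x) * spectral_density H x = 0"
      using integrable_spectral_density[OF H] nonneg
      by (simp add: spectral_constant_def integral_nonneg_eq_0_iff_AE)
    then have "AE x in lborel. x \<notin> {0<..<1::real}"
    proof eventually_elim
      case (elim x)
      show ?case
      proof
        assume x: "x \<in> {0<..<1}"
        then have "0 < sin (x / 2)"
          using pi_gt3 by (intro sin_gt_zero) auto
        then show False
          using elim x by (simp add: spectral_density_def one_minus_cos_eq)
      qed
    qed
    then have "{0<..<1::real} \<in> null_sets lborel"
      by (subst AE_iff_null_sets) auto
    then show False
      by (auto simp: null_sets_def)
  qed
  moreover have "0 \<le> spectral_constant H"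
    unfolding spectral_constant_def using nonneg by (intro integral_nonneg_AE) auto
  ultimately show ?thesis by simp
qed

text \<open>Substitute \<open>b * x\<close> for \<open>x\<close> with
  \<open>b = \<bar>a\<bar>\<close>. The density is homogeneous of degree \<open>- 1 - 2 * H\<close>,
  and the Jacobian accounts for one power of \<open>b\<close>, leaving
  \<open>b powr (2 * H)\<close>.\<close>

lemma has_bochner_integral_spectral:
  assumes H: "0 < H" "H < 1"
  shows "has_bochner_integral lborel (\<lambda>x. (1 - cos (a * x)) * spectral_density H x)
    (\<bar>a\<bar> powr (2 * H) * spectral_constant H)"
proof (cases "a = 0")
  case False
  define b where "b = \<bar>a\<bar>"
  have b: "0 < b" using False by (simp add: b_def)
  let ?f = "\<lambda>x. (1 - cos x) * spectral_density H x"
  have "has_bochner_integral lborel ?f (spectral_constant H)"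
    unfolding spectral_constant_def using integrable_spectral_density[OF H]
    by (simp add: has_bochner_integral_iff)
  then have "has_bochner_integral lborel (\<lambda>x. ?f (0 + b * x)) (spectral_constant H /\<^sub>R \<bar>b\<bar>)"
    using b by (subst (asm) lborel_has_bochner_integral_real_affine_iff[of b _ _ 0]) auto
  then have "has_bochner_integral lborel (\<lambda>x. b powr (1 + 2 * H) * ?f (0 + b * x))
      (b powr (1 + 2 * H) * (spectral_constant H /\<^sub>R \<bar>b\<bar>))"
    by (rule has_bochner_integral_mult_right)
  also have "b powr (1 + 2 * H) * (spectral_constant H /\<^sub>R \<bar>b\<bar>) = b powr (2 * H) * spectral_constant H"
    using b by (simp add: powr_add field_simps)
  also have "(\<lambda>x. b powr (1 + 2 * H) * ?f (0 + b * x)) =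
      (\<lambda>x. (1 - cos (a * x)) * spectral_density H x)"
  proof
    fix x
    have "cos (a * x) = cos (b * x)"
      by (cases "a < 0") (simp_all add: b_def)
    moreover have "b powr (1 + 2 * H) * spectral_density H (b * x) = spectral_density H x"
    proof (cases "0 < x")
      case True
      then have "b powr (1 + 2 * H) * spectral_density H (b * x) =
          b powr ((1 + 2 * H) + (- 1 - 2 * H)) * spectral_density H x"
        using b unfolding powr_add by (simp add: spectral_density_def powr_mult)
      then show ?thesis
        using b by simp
    next
      case False
      then show ?thesis
        using b by (simp add: spectral_density_def zero_less_mult_iff)
    qed
    ultimately show "b powr (1 + 2 * H) * ?f (0 + b * x) = (1 - cos (a * x)) * spectral_density H x"
      by simp
  qed
  finally show ?thesis by (simp add: b_def)
qed (simp add: has_bochner_integral_zero)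

lemma has_bochner_integral_nonneg:
  fixes f :: "'b \<Rightarrow> real"
  assumes "has_bochner_integral M f r" "\<And>x. 0 \<le> f x"
  shows "0 \<le> r"
  using Bochner_Integration.integral_nonneg[of M f] assms
  by (simp add: has_bochner_integral_integral_eq)

text \<open>Up to the spectral constant, the quadratic form is the integral of
  \<open>\<bar>\<Sum>\<^sub>i c\<^sub>i (1 - exp (\<i> \<tau>\<^sub>i x))\<bar>\<^sup>2\<close> against half the spectral density.\<close>

lemma psd_fbm_kernel:
  assumes H: "0 < H" "H < 1"
  shows "psd_kernel (\<lambda>i j. fbm_kernel H (\<tau> i) (\<tau> j))"
  unfolding psd_kernel_def
proof (intro conjI allI impI)
  show "fbm_kernel H (\<tau> i) (\<tau> j) = fbm_kernel H (\<tau> j) (\<tau> i)" for i j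
    by (simp add: fbm_kernel_def abs_minus_commute)
  fix F and c :: "'a \<Rightarrow> real"
  let ?h = "\<lambda>a x. (1 - cos (a * x)) * spectral_density H x"
  let ?C = "spectral_constant H"
  have "has_bochner_integral lborel
      (\<lambda>x. \<Sum>i\<in>F. \<Sum>j\<in>F. c i * c j / 2 * (?h (\<tau> i) x + ?h (\<tau> j) x - ?h (\<tau> i - \<tau> j) x))
      (\<Sum>i\<in>F. \<Sum>j\<in>F. c i * c j / 2 *
        (\<bar>\<tau> i\<bar> powr (2 * H) * ?C + \<bar>\<tau> j\<bar> powr (2 * H) * ?C - \<bar>\<tau> i - \<tau> j\<bar> powr (2 * H) * ?C))"
    by (intro has_bochner_integral_sum has_bochner_integral_mult_right has_bochner_integral_add
        has_bochner_integral_diff has_bochner_integral_spectral H)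
  moreover have "0 \<le> (\<Sum>i\<in>F. \<Sum>j\<in>F. c i * c j / 2 *
      (?h (\<tau> i) x + ?h (\<tau> j) x - ?h (\<tau> i - \<tau> j) x))" for x
  proof -
    \<comment> \<open>Expanding \<open>cos (\<tau> i * x - \<tau> j * x)\<close> separates the
      products of the real parts and of the imaginary parts, so that the double sum becomes a sum of
      two squares.\<close>
    have "c i * c j / 2 * (?h (\<tau> i) x + ?h (\<tau> j) x - ?h (\<tau> i - \<tau> j) x) =
        spectral_density H x / 2 * ((c i * (1 - cos (\<tau> i * x))) * (c j * (1 - cos (\<tau> j * x)))
          + (c i * sin (\<tau> i * x)) * (c j * sin (\<tau> j * x)))" for i j
      by (simp add: left_diff_distrib cos_diff field_simps)
    then have "(\<Sum>i\<in>F. \<Sum>j\<in>F. c i * c j / 2 * (?h (\<tau> i) x + ?h (\<tau> j) x - ?h (\<tau> i - \<tau> j) x)) =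
        spectral_density H x / 2 *
          ((\<Sum>i\<in>F. c i * (1 - cos (\<tau> i * x)))\<^sup>2 + (\<Sum>i\<in>F. c i * sin (\<tau> i * x))\<^sup>2)"
      by (simp only: power2_eq_square sum_product) (simp only: sum.distrib sum_distrib_left distrib_left)
    then show ?thesis
      by (simp only:) (simp add: spectral_density_nonneg)
  qed
  ultimately have "0 \<le> (\<Sum>i\<in>F. \<Sum>j\<in>F. c i * c j / 2 *
      (\<bar>\<tau> i\<bar> powr (2 * H) * ?C + \<bar>\<tau> j\<bar> powr (2 * H) * ?C - \<bar>\<tau> i - \<tau> j\<bar> powr (2 * H) * ?C))"
    by (rule has_bochner_integral_nonneg)
  also have "\<dots> = ?C * (\<Sum>i\<in>F. \<Sum>j\<in>F. c i * c j * fbm_kernel H (\<tau> i) (\<tau> j))"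
    by (simp add: fbm_kernel_def sum_distrib_left algebra_simps add_divide_distrib diff_divide_distrib)
  finally show "0 \<le> (\<Sum>i\<in>F. \<Sum>j\<in>F. c i * c j * fbm_kernel H (\<tau> i) (\<tau> j))"
    using spectral_constant_pos[OF H] by (simp add: zero_le_mult_iff)
qed

section \<open>Gaussian families\<close>

text \<open>Keeping the variance of every linear combination in the definition makes the covariance
  recoverable by polarisation, see \<open>gaussian_family_covariance\<close>.\<close>

definition gaussian_family :: "'w measure \<Rightarrow> ('i \<Rightarrow> 'i \<Rightarrow> real) \<Rightarrow> ('i \<Rightarrow> 'w \<Rightarrow> real) \<Rightarrow> bool" where
  "gaussian_family M K X \<longleftrightarrow> (\<forall>F c. finite F \<longrightarrow>
     centered_normal M (\<Sum>i\<in>F. \<Sum>j\<in>F. c i * c j * K i j) (\<lambda>\<omega>. \<Sum>i\<in>F. c i * X i \<omega>))"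

lemma gaussian_familyD:
  "gaussian_family M K X \<Longrightarrow> finite F \<Longrightarrow>
    centered_normal M (\<Sum>i\<in>F. \<Sum>j\<in>F. c i * c j * K i j) (\<lambda>\<omega>. \<Sum>i\<in>F. c i * X i \<omega>)"
  by (simp add: gaussian_family_def)

lemma gaussian_family_single: "gaussian_family M K X \<Longrightarrow> centered_normal M (K i i) (X i)"
  using gaussian_familyD[of M K X "{i}" "\<lambda>_. 1"] by simp

lemma gaussian_family_covariance:
  assumes X: "gaussian_family M K X" and sym: "K j i = K i j"
  shows "(\<integral>\<omega>. X i \<omega> * X j \<omega> \<partial>M) = K i j"
proof (cases "i = j")
  case True
  then show ?thesis
    using centered_normal_moments(4)[OF gaussian_family_single[OF X, of i]]
    by (simp add: power2_eq_square)
next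
  case False
  have "centered_normal M (K i i + 2 * K i j + K j j) (\<lambda>\<omega>. X i \<omega> + X j \<omega>)"
    using gaussian_familyD[OF X, of "{i, j}" "\<lambda>_. 1"] False sym by (simp add: algebra_simps)
  note Z = centered_normal_moments[OF this]
  note Xi = centered_normal_moments[OF gaussian_family_single[OF X, of i]]
  note Xj = centered_normal_moments[OF gaussian_family_single[OF X, of j]]
  have "(\<integral>\<omega>. X i \<omega> * X j \<omega> \<partial>M) = (\<integral>\<omega>. ((X i \<omega> + X j \<omega>)\<^sup>2 - (X i \<omega>)\<^sup>2 - (X j \<omega>)\<^sup>2) / 2 \<partial>M)"
    by (intro Bochner_Integration.integral_cong) (auto simp: power2_eq_square field_simps)
  also have "\<dots> = K i j"
    using Z Xi Xj by simp
  finally show ?thesis .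
qed

lemma gaussian_family_process:
  assumes "prob_space M" "gaussian_family M K X"
  shows "centered_gaussian_process M I X"
  unfolding centered_gaussian_process_def gaussian_process_def
proof (intro conjI ballI allI impI)
  show "X i \<in> borel_measurable M" "integral\<^sup>L M (X i) = 0" for i
    using gaussian_family_single[OF assms(2), of i] centered_normal_moments(2)
    by (simp add: centered_normal_def, blast)
  show "gaussian_rv M (\<lambda>\<omega>. \<Sum>i\<in>F. c i * X i \<omega>)" if "finite F \<and> F \<subseteq> I" for F c
    using that by (intro centered_normal_gaussian_rv[OF gaussian_familyD[OF assms(2)]]) simp
qed fact

text \<open>Moves a family to the space of functions on its index set. The final statement
  prescribes this type of sample space, whereas the noise lives on real sequences.\<close>

lemma gaussian_family_canonical:
  fixes X :: "'i \<Rightarrow> 'w \<Rightarrow> real"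
  assumes X: "gaussian_family M K X"
  shows "gaussian_family (distr M (PiM UNIV (\<lambda>_. borel)) (\<lambda>\<omega> i. X i \<omega>)) K (\<lambda>i \<omega>. \<omega> i)"
  unfolding gaussian_family_def
proof (intro allI impI)
  fix F :: "'i set" and c :: "'i \<Rightarrow> real" assume F: "finite F"
  have [measurable]: "X i \<in> borel_measurable M" for i
    using gaussian_family_single[OF X, of i] by (simp add: centered_normal_def)
  have meas: "(\<lambda>\<omega> i. X i \<omega>) \<in> measurable M (PiM UNIV (\<lambda>_. borel))"
    by (intro measurable_PiM_single') auto
  show "centered_normal (distr M (PiM UNIV (\<lambda>_. borel)) (\<lambda>\<omega> i. X i \<omega>))
      (\<Sum>i\<in>F. \<Sum>j\<in>F. c i * c j * K i j) (\<lambda>\<omega>. \<Sum>i\<in>F. c i * \<omega> i)"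
    using gaussian_familyD[OF X F, of c] unfolding centered_normal_def
    by (simp add: distr_distr[OF _ meas] comp_def)
qed

section \<open>Fractional Brownian motion\<close>

text \<open>The Cholesky factor is lower triangular, so each value is a finite sum and raises no
  convergence question.\<close>

definition cholesky_process :: "(nat \<Rightarrow> nat \<Rightarrow> real) \<Rightarrow> nat \<Rightarrow> (nat \<Rightarrow> real) \<Rightarrow> real" where
  "cholesky_process a i \<omega> = (\<Sum>k\<le>i. a i k * \<omega> k)"

lemma measurable_cholesky_process [measurable]:
  "cholesky_process a i \<in> borel_measurable gaussian_white_noise"
  using measurable_white_noise_coordinate unfolding cholesky_process_def by measurable

text \<open>The map \<open>p\<close> may repeat values, since different members of the family can
  share a dyadic approximation.\<close>

lemma centered_normal_cholesky_process:
  assumes K: "\<And>i j N. i < N \<Longrightarrow> K i j = (\<Sum>k<N. a i k * a j k)"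
    and a: "\<And>i k. i < k \<Longrightarrow> a i k = 0" and F: "finite F"
  shows "centered_normal gaussian_white_noise (\<Sum>s\<in>F. \<Sum>r\<in>F. c s * c r * K (p s) (p r))
    (\<lambda>\<omega>. \<Sum>s\<in>F. c s * cholesky_process a (p s) \<omega>)"
proof -
  \<comment> \<open>A common bound on the indices lets all the sums run over the same range, padded
    with zeros.\<close>
  obtain N where N: "\<And>s. s \<in> F \<Longrightarrow> p s < N"
    using finite_nat_set_iff_bounded[of "p ` F"] F by auto
  have "cholesky_process a (p s) \<omega> = (\<Sum>k<N. a (p s) k * \<omega> k)" if "s \<in> F" for s \<omega>
    unfolding cholesky_process_def using N[OF that] a
    by (intro sum.mono_neutral_left) auto
  then have Y: "(\<Sum>s\<in>F. c s * cholesky_process a (p s) \<omega>) = (\<Sum>k<N. (\<Sum>s\<in>F. c s * a (p s) k) * \<omega> k)" for \<omega>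
    by (simp add: sum_distrib_left sum_distrib_right sum.swap[of _ F] mult_ac)
  have "(\<Sum>s\<in>F. \<Sum>r\<in>F. c s * c r * K (p s) (p r)) =
      (\<Sum>s\<in>F. \<Sum>r\<in>F. \<Sum>k<N. (c s * a (p s) k) * (c r * a (p r) k))"
    using N by (intro sum.cong refl) (simp add: K[of _ N] sum_distrib_left mult_ac)
  also have "\<dots> = (\<Sum>k<N. (\<Sum>s\<in>F. c s * a (p s) k)\<^sup>2)"
    by (simp add: power2_eq_square sum_product sum.swap[of _ "{..<N}"])
  finally show ?thesis
    using centered_normal_white_noise[where N=N and b="\<lambda>k. \<Sum>s\<in>F. c s * a (p s) k"] by (simp add: Y)
qed

text \<open>The expected absolute increments are at most \<open>s n\<close>, so the total variation
  of the sequence has finite expectation. Almost surely the increments are then absolutely summable,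
  and they telescope.\<close>

lemma (in prob_space) AE_convergent_if_variances_summable:
  assumes Y: "\<And>n. centered_normal M (v n) (\<lambda>\<omega>. Y (Suc n) \<omega> - Y n \<omega>)"
    and v: "\<And>n. v n \<le> (s n)\<^sup>2" and s: "\<And>n. 0 < s n" "summable s"
  shows "AE \<omega> in M. convergent (\<lambda>n. Y n \<omega>)"
proof -
  define D where "D n \<omega> = Y (Suc n) \<omega> - Y n \<omega>" for n \<omega>
  have D: "centered_normal M (v n) (D n)" for n
    using Y[of n] by (simp add: D_def[abs_def])
  have [measurable]: "D n \<in> borel_measurable M" for n
    using D[of n] by (simp add: centered_normal_def)
  note mom = centered_normal_moments[OF D]
  have bound: "(\<integral>\<^sup>+\<omega>. ennreal \<bar>D n \<omega>\<bar> \<partial>M) \<le> ennreal (s n)" for n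
  proof -
    \<comment> \<open>AM-GM, in place of Jensen's inequality for the second moment\<close>
    have "\<bar>D n \<omega>\<bar> \<le> ((D n \<omega>)\<^sup>2 / s n + s n) / 2" for \<omega>
    proof -
      have "0 \<le> (\<bar>D n \<omega>\<bar> - s n)\<^sup>2" by simp
      then show ?thesis
        using s(1)[of n] by (simp add: power2_diff field_simps power2_eq_square)
    qed
    then have "(\<integral>\<^sup>+\<omega>. ennreal \<bar>D n \<omega>\<bar> \<partial>M) \<le> (\<integral>\<^sup>+\<omega>. ennreal (((D n \<omega>)\<^sup>2 / s n + s n) / 2) \<partial>M)"
      by (intro nn_integral_mono ennreal_leI)
    also have "\<dots> = ennreal (\<integral>\<omega>. ((D n \<omega>)\<^sup>2 / s n + s n) / 2 \<partial>M)"
      using mom(3)[of n] s(1)[of n] by (intro nn_integral_eq_integral) (auto simp: less_imp_le)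
    also have "(\<integral>\<omega>. ((D n \<omega>)\<^sup>2 / s n + s n) / 2 \<partial>M) = (v n / s n + s n) / 2"
      using mom(3,4)[of n] by (simp add: prob_space)
    also have "\<dots> \<le> s n"
      using v[of n] s(1)[of n] by (simp add: field_simps power2_eq_square)
    finally show ?thesis
      by (simp add: ennreal_leI)
  qed
  have "(\<integral>\<^sup>+\<omega>. (\<Sum>n. ennreal \<bar>D n \<omega>\<bar>) \<partial>M) = (\<Sum>n. \<integral>\<^sup>+\<omega>. ennreal \<bar>D n \<omega>\<bar> \<partial>M)"
    by (rule nn_integral_suminf) measurable
  also have "\<dots> \<le> (\<Sum>n. ennreal (s n))"
    by (intro suminf_le bound) auto
  also have "\<dots> < \<infinity>"
    using s by (subst suminf_ennreal_eq[OF _ summable_sums]) (auto simp: less_imp_le)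
  finally have "AE \<omega> in M. (\<Sum>n. ennreal \<bar>D n \<omega>\<bar>) \<noteq> \<infinity>"
    by (intro nn_integral_PInf_AE) auto
  then show ?thesis
  proof eventually_elim
    case (elim \<omega>)
    then have "summable (\<lambda>n. \<bar>D n \<omega>\<bar>)"
      by (intro summable_suminf_not_top) auto
    then have "summable (\<lambda>n. D n \<omega>)"
      by (rule summable_rabs_cancel)
    then have "convergent (\<lambda>n. (\<Sum>i<n. D i \<omega>) + Y 0 \<omega>)"
      by (intro convergent_add convergent_const) (simp add: summable_iff_convergent)
    then show ?case
      using sum_lessThan_telescope[of "\<lambda>n. Y n \<omega>"] by (simp add: D_def)
  qed
qed

text \<open>Each dyadic rational occurs infinitely often in this enumeration, so the covariance matrix
  along it is only positive semidefinite.\<close>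

definition dyadic :: "nat \<Rightarrow> real" where
  "dyadic i = (case prod_decode i of (n, j) \<Rightarrow> real j / 2 ^ n)"

text \<open>For \<open>t \<ge> 0\<close> this is the position of the truncation of \<open>t\<close>
  to \<open>n\<close> binary digits after the point.\<close>

definition dyadic_index :: "real \<Rightarrow> nat \<Rightarrow> nat" where
  "dyadic_index t n = prod_encode (n, nat \<lfloor>2 ^ n * t\<rfloor>)"

lemma dyadic_index_bounds:
  assumes "0 \<le> t"
  shows "\<bar>dyadic (dyadic_index t n) - t\<bar> \<le> (1/2) ^ n"
proof -
  have "dyadic (dyadic_index t n) = real_of_int \<lfloor>2 ^ n * t\<rfloor> / 2 ^ n"
    using assms by (simp add: dyadic_def dyadic_index_def)
  then have "dyadic (dyadic_index t n) - t = (real_of_int \<lfloor>2 ^ n * t\<rfloor> - 2 ^ n * t) / 2 ^ n"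
    by (simp add: field_simps)
  moreover have "\<bar>real_of_int \<lfloor>2 ^ n * t\<rfloor> - 2 ^ n * t\<bar> \<le> 1"
    by linarith
  ultimately show ?thesis
    by (simp add: abs_divide power_one_over divide_right_mono)
qed

lemma dyadic_index_tendsto:
  assumes "0 \<le> t"
  shows "(\<lambda>n. dyadic (dyadic_index t n)) \<longlonglongrightarrow> t"
proof (rule LIM_zero_cancel, rule Lim_null_comparison)
  show "(\<lambda>n. (1/2::real) ^ n) \<longlonglongrightarrow> 0"
    by (intro LIMSEQ_power_zero) simp
qed (use dyadic_index_bounds[OF assms] in simp)

text \<open>The positive exponent \<open>2 * H\<close> makes the power continuous also at base 0,
  where \<open>s\<close>, \<open>t\<close> or \<open>s - t\<close> may vanish.\<close>

lemma tendsto_fbm_kernel: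
  assumes "0 < H" "(f \<longlongrightarrow> s) G" "(g \<longlongrightarrow> t) G"
  shows "((\<lambda>x. fbm_kernel H (f x) (g x)) \<longlongrightarrow> fbm_kernel H s t) G"
  unfolding fbm_kernel_def using assms by (intro tendsto_intros tendsto_powr') auto

lemma fbm_exists:
  fixes \<tau> :: "'i \<Rightarrow> real"
  assumes H: "0 < H" "H < 1" and \<tau>: "\<And>i. 0 \<le> \<tau> i"
  shows "\<exists>X. gaussian_family gaussian_white_noise (\<lambda>i j. fbm_kernel H (\<tau> i) (\<tau> j)) X"
proof -
  interpret prob_space gaussian_white_noise by (rule prob_space_white_noise)
  obtain a where a: "\<And>i j N. i < N \<Longrightarrow> fbm_kernel H (dyadic i) (dyadic j) = (\<Sum>k<N. a i k * a j k)"
    "\<And>i k. i < k \<Longrightarrow> a i k = 0"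
    using cholesky_factorisation[OF psd_fbm_kernel[OF H, of dyadic]] by blast
  define p where "p i n = dyadic_index (\<tau> i) n" for i n
  define Y where "Y i n = cholesky_process a (p i n)" for i n
  \<comment> \<open>Where the sequence diverges \<open>lim\<close> is arbitrary; for each fixed
    \<open>i\<close> this happens only on a null set.\<close>
  define X where "X i \<omega> = lim (\<lambda>n. Y i n \<omega>)" for i \<omega>
  have [measurable]: "Y i n \<in> borel_measurable gaussian_white_noise" for i n
    unfolding Y_def by measurable
  have [measurable]: "X i \<in> borel_measurable gaussian_white_noise" for i
    unfolding X_def by measurable
  have conv: "AE \<omega> in gaussian_white_noise. convergent (\<lambda>n. Y i n \<omega>)" for i
  proof (rule AE_convergent_if_variances_summable)
    fix n
    \<comment> \<open>The increment is written as a linear combination over the two elements of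
      \<open>bool\<close>, with \<open>True\<close> for the finer level, to fit the lemma on linear
      combinations.\<close>
    let ?d = "\<lambda>b. dyadic (p i (if b then Suc n else n))"
    let ?c = "\<lambda>b. if b then 1 else - 1 :: real"
    have "centered_normal gaussian_white_noise
        (\<Sum>b\<in>UNIV. \<Sum>b'\<in>UNIV. ?c b * ?c b' * fbm_kernel H (?d b) (?d b'))
        (\<lambda>\<omega>. \<Sum>b\<in>UNIV. ?c b * cholesky_process a (p i (if b then Suc n else n)) \<omega>)"
      by (intro centered_normal_cholesky_process[where K="\<lambda>i j. fbm_kernel H (dyadic i) (dyadic j)"] a) simp_all
    then show "centered_normal gaussian_white_noise
        (\<bar>dyadic (p i (Suc n)) - dyadic (p i n)\<bar> powr (2 * H)) (\<lambda>\<omega>. Y i (Suc n) \<omega> - Y i n \<omega>)"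
      using H by (simp add: UNIV_bool Y_def fbm_kernel_def abs_minus_commute field_simps)
    \<comment> \<open>The errors at levels \<open>n\<close> and \<open>Suc n\<close> add up to at
      most \<open>2 * (1/2) ^ n\<close>.\<close>
    have "\<bar>dyadic (p i (Suc n)) - dyadic (p i n)\<bar> \<le> 2 * (1/2) ^ n"
      using dyadic_index_bounds[OF \<tau>[of i], of n] dyadic_index_bounds[OF \<tau>[of i], of "Suc n"]
        zero_le_power[of "1/2 :: real" n] unfolding p_def power_Suc by linarith
    then have "\<bar>dyadic (p i (Suc n)) - dyadic (p i n)\<bar> powr (2 * H) \<le> (2 * (1/2) ^ n) powr (2 * H)"
      using H by (intro powr_mono2) auto
    also have "\<dots> = ((2 * (1/2) ^ n) powr H)\<^sup>2"
      by (simp add: power2_eq_square powr_add[symmetric])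
    \<comment> \<open>This exhibits the bound on the standard deviation as a geometric sequence with
      ratio \<open>(1/2) powr H\<close>, which is below 1 because \<open>0 < H\<close>.\<close>
    also have "(2 * (1/2) ^ n) powr H = 2 powr H * ((1/2) powr H) ^ n"
    proof -
      have "((1/2) ^ n) powr H = ((1/2::real) powr H) ^ n"
        by (induction n) (simp, simp only: power_Suc powr_mult)
      then show ?thesis by (simp add: powr_mult)
    qed
    finally show "\<bar>dyadic (p i (Suc n)) - dyadic (p i n)\<bar> powr (2 * H) \<le> (2 powr H * ((1/2) powr H) ^ n)\<^sup>2" .
    show "0 < 2 powr H * ((1/2) powr H) ^ n"
      by simp
  next
    have "(1/2) powr H < (1::real)"
      using H powr_less_mono2[of H "1/2" 1] by simp
    then show "summable (\<lambda>n. 2 powr H * ((1/2) powr H) ^ n)"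
      by (intro summable_mult summable_geometric) simp
  qed
  have "centered_normal gaussian_white_noise
      (\<Sum>i\<in>F. \<Sum>j\<in>F. c i * c j * fbm_kernel H (\<tau> i) (\<tau> j)) (\<lambda>\<omega>. \<Sum>i\<in>F. c i * X i \<omega>)"
    if F: "finite F" for F c
  proof (rule centered_normal_limit)
    show "centered_normal gaussian_white_noise
      (\<Sum>i\<in>F. \<Sum>j\<in>F. c i * c j * fbm_kernel H (dyadic (p i n)) (dyadic (p j n)))
      (\<lambda>\<omega>. \<Sum>i\<in>F. c i * Y i n \<omega>)" for n
      unfolding Y_def
      by (intro centered_normal_cholesky_process[where K="\<lambda>i j. fbm_kernel H (dyadic i) (dyadic j)"] a F)
    \<comment> \<open>The exceptional null sets depend on \<open>i\<close>; they can be united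
      because \<open>F\<close> is finite.\<close>
    have "AE \<omega> in gaussian_white_noise. \<forall>i\<in>F. convergent (\<lambda>n. Y i n \<omega>)"
      using F conv by (intro AE_finite_allI) auto
    then show "AE \<omega> in gaussian_white_noise. (\<lambda>n. \<Sum>i\<in>F. c i * Y i n \<omega>) \<longlonglongrightarrow> (\<Sum>i\<in>F. c i * X i \<omega>)"
      by eventually_elim (auto intro!: tendsto_intros simp: X_def convergent_LIMSEQ_iff)
    show "(\<lambda>n. \<Sum>i\<in>F. \<Sum>j\<in>F. c i * c j * fbm_kernel H (dyadic (p i n)) (dyadic (p j n)))
        \<longlonglongrightarrow> (\<Sum>i\<in>F. \<Sum>j\<in>F. c i * c j * fbm_kernel H (\<tau> i) (\<tau> j))"
      unfolding p_def by (intro tendsto_intros tendsto_fbm_kernel H dyadic_index_tendsto \<tau>)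
  qed measurable
  then show ?thesis
    by (auto simp: gaussian_family_def)
qed

section \<open>From times to totally ordered sets\<close>

lemma measure_sym_diff_subset:
  fixes m :: "'a::t2_space measure"
  assumes "radon_measure m" "compact U" "compact V" "U \<subseteq> V \<or> V \<subseteq> U"
  shows "measure m (sym_diff U V) = \<bar>measure m U - measure m V\<bar>"
proof -
  have *: "measure m (sym_diff A B) = \<bar>measure m A - measure m B\<bar>"
    if "compact A" "compact B" "A \<subseteq> B" for A B :: "'a set"
  proof -
    have "A \<in> sets m" "B \<in> sets m"
      using assms(1) that borel_closed[OF compact_imp_closed] by (simp_all add: radon_measure_def)
    \<comment> \<open>Finite mass on compact sets is what makes the real-valued
      \<open>measure\<close> subtractive here.\<close>
    moreover have "emeasure m B < \<infinity>"
      using assms(1) that by (auto simp: radon_measure_def)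
    ultimately have "A \<in> fmeasurable m" "B \<in> fmeasurable m"
      using that emeasure_mono[of A B m] by (auto simp: fmeasurable_def top.not_eq_extremum)
    moreover have "sym_diff A B = B - A"
      using that by auto
    ultimately show ?thesis
      using measure_mono_fmeasurable[of A B m] measurable_measure_Diff[of B m A] that
      by (simp add: fmeasurableD)
  qed
  show ?thesis
    using assms(4)
  proof
    assume "V \<subseteq> U"
    then show ?thesis
      using *[of V U] assms by (simp add: Un_commute abs_minus_commute)
  qed (use *[of U V] assms in simp)
qed

theorem theorem4p3:
  fixes m :: "'a::metric_space measure" and \<A> :: "'a set set"
  assumes "locally compact (UNIV :: 'a set)"
    and "radon_measure m"
    and "indexing_collection \<A>"
    and "\<forall>U\<in>\<A>. \<forall>V\<in>\<A>. U \<subseteq> V \<or> V \<subseteq> U"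
  shows "\<forall>H. 0 < H \<and> H < 1 \<longrightarrow>
    (\<exists>(M :: ('a set \<Rightarrow> real) measure) X. set_indexed_fBm m \<A> H M X)"
proof (intro allI impI, elim conjE)
  fix H :: real assume H: "0 < H" "H < 1"
  \<comment> \<open>The time attached to a set is its measure. This kernel is semidefinite on all
    sets; the total order enters only when \<open>\<bar>measure m U - measure m V\<bar>\<close> is
    identified with the measure of the symmetric difference.\<close>
  let ?K = "\<lambda>U V. fbm_kernel H (measure m U) (measure m V)"
  obtain X where X: "gaussian_family gaussian_white_noise ?K X"
    using fbm_exists[OF H, of "measure m"] by auto
  define M where "M = distr gaussian_white_noise (PiM UNIV (\<lambda>_. borel)) (\<lambda>\<omega> U. X U \<omega>)"
  have M: "gaussian_family M ?K (\<lambda>U \<omega>. \<omega> U)"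
    unfolding M_def by (rule gaussian_family_canonical[OF X])
  have "(\<lambda>\<omega> U. X U \<omega>) \<in> measurable gaussian_white_noise (PiM UNIV (\<lambda>_. borel))"
    using gaussian_family_single[OF X] by (intro measurable_PiM_single') (auto simp: centered_normal_def)
  then have "prob_space M"
    unfolding M_def by (rule prob_space.prob_space_distr[OF prob_space_white_noise])
  have compact: "compact U" if "U \<in> \<A>" for U
    using assms(3) that indexing_collection_data.compact_connected
    unfolding indexing_collection_def by blast
  have "(\<integral>\<omega>. \<omega> U * \<omega> V \<partial>M) = 1/2 * (measure m U powr (2*H) + measure m V powr (2*H)
      - measure m (sym_diff U V) powr (2*H))" if "U \<in> \<A>" "V \<in> \<A>" for U V
    using gaussian_family_covariance[OF M, of V U] that assms(4)
      measure_sym_diff_subset[OF assms(2) compact compact, of U V]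
    by (simp add: fbm_kernel_def abs_minus_commute)
  then have "set_indexed_fBm m \<A> H M (\<lambda>U \<omega>. \<omega> U)"
    using gaussian_family_process[OF \<open>prob_space M\<close> M] by (simp add: set_indexed_fBm_def)
  then show "\<exists>(M :: ('a set \<Rightarrow> real) measure) X. set_indexed_fBm m \<A> H M X"
    by blast
qed

end
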